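(* Let $n\ge 1$ and let $M\in\mathcal{M}_n(\mathbb{R})$ be such that $\|M\|_2\leq 1$. Then $K:=\frac{1}{2}(I_n-M)$ is a DPP kernel.
   Context: $[n]=\{1,\dots,n\}$; $\mathcal{M}_n(\mathbb{R})$ is the set of real $n\times n$ matrices; $I_n$ is the identity matrix; $\|M\|_2$ is the spectral norm (largest singular value). For $S\subset[n]$, $K_S$ is the principal submatrix of $K$ with rows and columns indexed by $S$, with $\det(K_\emptyset)=1$. The determinantal measure with kernel $K$ is the unique signed measure $\mu$ on the power set $\mathcal{P}([n])$ such that $\mu(\{X\in\mathcal{P}([n]): S\subset X\})=\det(K_S)$ for all $S\subset[n]$. $K$ is called a DPP kernel if this $\mu$ is a probability measure. Kernels are not assumed symmetric. *)

theory Defs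
  imports
    "HOL-Probability.Probability_Measure"
    "Jordan_Normal_Form.Char_Poly"
    "Jordan_Normal_Form.DL_Submatrix"
begin

text \<open>
  Matrices are the carrier-based ones of Jordan_Normal_Form, so \<^term>\<open>n\<close> is an ordinary
  natural number. Rows and columns are numbered from 0: the index set $[n]$ is
  \<^term>\<open>{..<n}\<close>.
\<close>

definition singular_values :: "real mat \<Rightarrow> real set" where
  "singular_values M = {sqrt e | e. eigenvalue (transpose_mat M * M) e}"

text \<open>
  \<^const>\<open>Max\<close> is meaningful for a matrix with at least one column: the set of singular values is
  then finite and nonempty, the Gram matrix being symmetric.
\<close>

definition spectral_norm :: "real mat \<Rightarrow> real" where
  "spectral_norm M = Max (singular_values M)"

text \<open>
  The submatrix keeps the selected rows and columns in increasing order; for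
  \<^term>\<open>S = {}\<close> it is the \<open>0 \<times> 0\<close> matrix, whose determinant is 1.
\<close>

definition principal_submatrix :: "'a mat \<Rightarrow> nat set \<Rightarrow> 'a mat" where
  "principal_submatrix K S = submatrix K S S"

lemma det_principal_submatrix_empty:
  "Determinant.det (principal_submatrix (K :: real mat) {}) = 1"
  by (simp add: principal_submatrix_def submatrix_def)

definition signed_measure_on :: "'a set set \<Rightarrow> ('a set \<Rightarrow> real) \<Rightarrow> bool" where
  "signed_measure_on \<A> \<mu> \<longleftrightarrow> \<mu> {} = 0 \<and>
     (\<forall>A :: nat \<Rightarrow> 'a set. range A \<subseteq> \<A> \<longrightarrow> disjoint_family A \<longrightarrow> (\<Union>i. A i) \<in> \<A> \<longrightarrow>
        (\<lambda>i. \<mu> (A i)) sums \<mu> (\<Union>i. A i))"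

text \<open>
  The values of \<open>\<mu>\<close> outside \<^term>\<open>Pow (Pow {..<n})\<close> are irrelevant; on it, \<open>\<mu>\<close> exists and is
  unique (\<open>determinantal_measure_exists\<close>, \<open>determinantal_measure_unique\<close>).
\<close>

definition determinantal_measure :: "nat \<Rightarrow> real mat \<Rightarrow> (nat set set \<Rightarrow> real) \<Rightarrow> bool" where
  "determinantal_measure n K \<mu> \<longleftrightarrow> signed_measure_on (Pow (Pow {..<n})) \<mu> \<and>
     (\<forall>S \<subseteq> {..<n}. \<mu> {X \<in> Pow {..<n}. S \<subseteq> X} = Determinant.det (principal_submatrix K S))"

definition DPP_kernel :: "nat \<Rightarrow> real mat \<Rightarrow> bool" where
  "DPP_kernel n K \<longleftrightarrow> K \<in> carrier_mat n n \<and>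
     (\<exists>P. prob_space P \<and> sets P = Pow (Pow {..<n}) \<and> determinantal_measure n K (measure P))"

lemma signed_measure_on_Un:
  assumes "signed_measure_on (Pow \<Omega>) \<mu>" "A \<subseteq> \<Omega>" "B \<subseteq> \<Omega>" "A \<inter> B = {}"
  shows "\<mu> (A \<union> B) = \<mu> A + \<mu> B"
proof -
  have 0: "\<mu> {} = 0"
    using assms(1) by (simp add: signed_measure_on_def)
  have "range (binaryset A B) \<subseteq> Pow \<Omega>" "(\<Union>i. binaryset A B i) \<in> Pow \<Omega>"
    using assms(2,3) by (auto simp: range_binaryset_eq UN_binaryset_eq)
  moreover have "disjoint_family (binaryset A B)"
    using assms(4) by (auto simp: disjoint_family_on_def binaryset_def)
  ultimately have "(\<lambda>i. \<mu> (binaryset A B i)) sums \<mu> (\<Union>i. binaryset A B i)"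
    using assms(1) unfolding signed_measure_on_def by blast
  moreover have "(\<lambda>i. \<mu> (binaryset A B i)) sums (\<mu> A + \<mu> B)"
    using binaryset_sums[of \<mu> A B] 0 by simp
  ultimately show ?thesis
    by (simp add: UN_binaryset_eq sums_unique2)
qed

lemma signed_measure_on_eq_sum:
  assumes "signed_measure_on (Pow \<Omega>) \<mu>" "A \<subseteq> \<Omega>" "finite A"
  shows "\<mu> A = (\<Sum>x\<in>A. \<mu> {x})"
  using assms(3,2)
proof (induction A rule: finite_induct)
  case empty
  then show ?case using assms(1) by (simp add: signed_measure_on_def)
next
  case (insert x A)
  then show ?case
    using signed_measure_on_Un[OF assms(1), of "{x}" A] by simp
qed

lemma determinantal_measure_unique:
  assumes "determinantal_measure n K \<mu>" "determinantal_measure n K \<nu>" "A \<subseteq> Pow {..<n}"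
  shows "\<mu> A = \<nu> A"
proof -
  have sm: "signed_measure_on (Pow (Pow {..<n})) \<mu>" "signed_measure_on (Pow (Pow {..<n})) \<nu>"
    using assms by (auto simp: determinantal_measure_def)
  have fin: "finite B" if "B \<subseteq> Pow {..<n}" for B
    using finite_subset[OF that] by simp
  have single: "\<mu> {X} = \<nu> {X}" if "X \<subseteq> {..<n}" for X
    using that
  proof (induction "n - card X" arbitrary: X rule: less_induct)
    case less
    let ?U = "{Y \<in> Pow {..<n}. X \<subseteq> Y}"
    have finU: "finite ?U" and X: "X \<in> ?U"
      using less.prems by auto
    have "\<mu> {Y} = \<nu> {Y}" if "Y \<in> ?U - {X}" for Y
    proof (rule less.hyps)
      have "finite Y" using that finite_subset[of Y "{..<n}"] by simp
      then have "card X < card Y" using that by (intro psubset_card_mono) auto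
      moreover have "card Y \<le> n" using that card_mono[of "{..<n}" Y] by auto
      ultimately show "n - card Y < n - card X" by simp
    qed (use that in auto)
    then have "(\<Sum>Y\<in>?U - {X}. \<mu> {Y}) = (\<Sum>Y\<in>?U - {X}. \<nu> {Y})"
      by (rule sum.cong[OF refl])
    moreover have "\<mu> ?U = \<nu> ?U"
      using assms less.prems by (simp add: determinantal_measure_def)
    moreover have "\<mu> ?U = (\<Sum>Y\<in>?U. \<mu> {Y})" "\<nu> ?U = (\<Sum>Y\<in>?U. \<nu> {Y})"
      by (intro signed_measure_on_eq_sum[OF sm(1)] signed_measure_on_eq_sum[OF sm(2)] finU; blast)+
    moreover have "(\<Sum>Y\<in>?U. \<mu> {Y}) = \<mu> {X} + (\<Sum>Y\<in>?U - {X}. \<mu> {Y})"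
      "(\<Sum>Y\<in>?U. \<nu> {Y}) = \<nu> {X} + (\<Sum>Y\<in>?U - {X}. \<nu> {Y})"
      by (rule sum.remove[OF finU X])+
    ultimately show ?case
      by linarith
  qed
  have "\<mu> A = (\<Sum>X\<in>A. \<mu> {X})"
    by (rule signed_measure_on_eq_sum[OF sm(1) assms(3) fin[OF assms(3)]])
  also have "\<dots> = (\<Sum>X\<in>A. \<nu> {X})"
    using single assms(3) by (intro sum.cong) auto
  also have "\<dots> = \<nu> A"
    by (rule signed_measure_on_eq_sum[OF sm(2) assms(3) fin[OF assms(3)], symmetric])
  finally show ?thesis .
qed

lemma signed_measure_on_sum:
  assumes "finite \<Omega>"
  shows "signed_measure_on (Pow \<Omega>) (\<lambda>A. \<Sum>x\<in>A. p x)"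
  unfolding signed_measure_on_def
proof (intro conjI allI impI)
  fix A :: "nat \<Rightarrow> 'a set"
  assume A: "range A \<subseteq> Pow \<Omega>" "disjoint_family A" "(\<Union>i. A i) \<in> Pow \<Omega>"
  have eq: "(\<Sum>x\<in>B. p x) = (\<Sum>x\<in>\<Omega>. if x \<in> B then p x else 0)" if "B \<subseteq> \<Omega>" for B
    using that assms by (intro sum.mono_neutral_cong_left) auto
  have "(\<lambda>i. if x \<in> A i then p x else 0) sums (if x \<in> (\<Union>i. A i) then p x else 0)" for x
  proof (cases "x \<in> (\<Union>i. A i)")
    case True
    then obtain k where k: "x \<in> A k" by blast
    then have "x \<in> A i \<longleftrightarrow> i = k" for i
      using A(2) by (auto simp: disjoint_family_on_def)
    then show ?thesis
      using sums_single[of k "\<lambda>_. p x"] True by simp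
  qed auto
  then have "(\<lambda>i. \<Sum>x\<in>\<Omega>. if x \<in> A i then p x else 0) sums
             (\<Sum>x\<in>\<Omega>. if x \<in> (\<Union>i. A i) then p x else 0)"
    by (rule sums_sum)
  moreover have "(\<lambda>i. \<Sum>x\<in>A i. p x) = (\<lambda>i. \<Sum>x\<in>\<Omega>. if x \<in> A i then p x else 0)"
    using A(1) by (intro ext eq) blast
  moreover have "(\<Sum>x\<in>(\<Union>i. A i). p x) = (\<Sum>x\<in>\<Omega>. if x \<in> (\<Union>i. A i) then p x else 0)"
    using A(3) by (intro eq) blast
  ultimately show "(\<lambda>i. \<Sum>x\<in>A i. p x) sums (\<Sum>x\<in>(\<Union>i. A i). p x)"
    by simp
qed simp

lemma sum_alternating_Pow:
  assumes "finite A"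
  shows "(\<Sum>X\<in>Pow A. (-1) ^ card X :: real) = (if A = {} then 1 else 0)"
proof (cases "A = {}")
  case False
  then obtain a B where AB: "A = insert a B" "a \<notin> B" by (metis all_not_in_conv mk_disjoint_insert)
  have B: "finite B" using assms AB by simp
  have "(\<Sum>X\<in>insert a ` Pow B. (-1) ^ card X :: real) = (\<Sum>X\<in>Pow B. (-1) ^ card (insert a X))"
    using AB(2) by (subst sum.reindex) (auto simp: inj_on_def)
  also have "\<dots> = (\<Sum>X\<in>Pow B. - ((-1) ^ card X))"
  proof (rule sum.cong[OF refl])
    fix X assume "X \<in> Pow B"
    then have "finite X" "a \<notin> X" using B AB(2) finite_subset by auto
    then show "(-1) ^ card (insert a X) = - ((-1) ^ card X :: real)" by simp
  qed
  finally have "(\<Sum>X\<in>insert a ` Pow B. (-1) ^ card X :: real) = - (\<Sum>X\<in>Pow B. (-1) ^ card X)"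
    by (simp add: sum_negf)
  moreover have "(\<Sum>X\<in>Pow A. (-1) ^ card X :: real) =
      (\<Sum>X\<in>Pow B. (-1) ^ card X) + (\<Sum>X\<in>insert a ` Pow B. (-1) ^ card X)"
    unfolding AB(1) Pow_insert using B AB(2) by (intro sum.union_disjoint) auto
  ultimately show ?thesis using False by simp
qed simp

lemma determinantal_measure_exists: "\<exists>\<mu>. determinantal_measure n K \<mu>"
proof -
  define d where "d S = Determinant.det (principal_submatrix K S)" for S
  define p where "p X = (\<Sum>T\<in>{T\<in>Pow {..<n}. X \<subseteq> T}. (-1) ^ card (T - X) * d T)" for X
  have "(\<Sum>X\<in>{X \<in> Pow {..<n}. S \<subseteq> X}. p X) = d S" if S: "S \<subseteq> {..<n}" for S
  proof -
    have inner: "(\<Sum>X\<in>{X\<in>Pow {..<n}. S \<subseteq> X \<and> X \<subseteq> T}. (-1) ^ card (T - X) :: real) =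
        (if T = S then 1 else 0)" if T: "T \<subseteq> {..<n}" "S \<subseteq> T" for T
    proof -
      have "(\<Sum>X\<in>{X\<in>Pow {..<n}. S \<subseteq> X \<and> X \<subseteq> T}. (-1) ^ card (T - X) :: real) =
          (\<Sum>Y\<in>Pow (T - S). (-1) ^ card Y)"
        by (rule sum.reindex_bij_witness[of _ "\<lambda>Y. T - Y" "\<lambda>X. T - X"])
           (use T in \<open>auto simp: double_diff\<close>)
      also have "\<dots> = (if T = S then 1 else 0)"
        using T finite_subset[OF T(1)] by (subst sum_alternating_Pow) auto
      finally show ?thesis .
    qed
    have "(\<Sum>X\<in>{X \<in> Pow {..<n}. S \<subseteq> X}. p X) =
        (\<Sum>T\<in>Pow {..<n}. \<Sum>X\<in>{X\<in>{X\<in>Pow {..<n}. S \<subseteq> X}. X \<subseteq> T}. (-1) ^ card (T - X) * d T)"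
      unfolding p_def by (rule sum.swap_restrict) auto
    also have "\<dots> = (\<Sum>T\<in>Pow {..<n}. if T = S then d T else 0)"
    proof (rule sum.cong[OF refl])
      fix T assume T: "T \<in> Pow {..<n}"
      have "(\<Sum>X\<in>{X\<in>{X\<in>Pow {..<n}. S \<subseteq> X}. X \<subseteq> T}. (-1) ^ card (T - X) * d T) =
          (\<Sum>X\<in>{X\<in>Pow {..<n}. S \<subseteq> X \<and> X \<subseteq> T}. (-1) ^ card (T - X)) * d T"
        by (simp add: sum_distrib_right)
      also have "\<dots> = (if T = S then d T else 0)"
      proof (cases "S \<subseteq> T")
        case True
        then show ?thesis using inner[of T] T by simp
      next
        case False
        then have e: "{X\<in>Pow {..<n}. S \<subseteq> X \<and> X \<subseteq> T} = {}" by blast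
        show ?thesis unfolding e using False by auto
      qed
      finally show "(\<Sum>X\<in>{X\<in>{X\<in>Pow {..<n}. S \<subseteq> X}. X \<subseteq> T}. (-1) ^ card (T - X) * d T) =
        (if T = S then d T else 0)" .
    qed
    also have "\<dots> = d S"
      using S by simp
    finally show ?thesis .
  qed
  then have "determinantal_measure n K (\<lambda>A. \<Sum>X\<in>A. p X)"
    unfolding determinantal_measure_def d_def by (simp add: signed_measure_on_sum)
  then show ?thesis by (intro exI[of "\<lambda>\<mu>. determinantal_measure n K \<mu>"])
qed

end

theory Submission
  imports Defs
begin

text \<open>
  Write \<open>I\<close> for the identity matrix. The candidate for the probability of a single set \<open>X\<close> is
  the determinant \<open>p X\<close> of the matrix whose rows are those of \<open>K\<close> at the indices in \<open>X\<close> and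
  those of \<open>I - K\<close> elsewhere. Two facts make \<open>p\<close> the density that is wanted.

  The determinant is additive in each row. Summing \<open>p\<close> over all \<open>X \<supseteq> S\<close> therefore leaves
  the rows of \<open>K\<close> at the indices in \<open>S\<close> and adds up \<open>K\<close> and \<open>I - K\<close>, that is, to rows of the
  identity, at all others; the determinant of that matrix is the principal minor of \<open>K\<close>
  on \<open>S\<close> (\<open>sum_over_supersets_eq_minor\<close>). For \<open>S = {}\<close> this gives total mass 1. So \<open>K\<close> is a
  DPP kernel as soon as all \<open>p X\<close> are nonnegative (\<open>DPP_kernelI\<close>).

  For \<open>K = (I - M) / 2\<close> one has \<open>I - K = (I + M) / 2\<close>. Hence \<open>p X\<close> is \<open>det (I - N) / 2 ^ n\<close>,
  where \<open>N\<close> is \<open>M\<close> with the rows outside \<open>X\<close> negated. Negating rows does not change the norm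
  of an image, so \<open>N\<close> is a contraction like \<open>M\<close>. For \<open>0 \<le> t < 1\<close> the strict contraction \<open>t N\<close>
  fixes only the zero vector, so \<open>det (I - t N)\<close> has no zero; it starts at 1 for \<open>t = 0\<close> and
  cannot be negative at \<open>t = 1\<close> (\<open>det_one_minus_contraction_nonneg\<close>).

  It remains to pass from the spectral norm, defined through eigenvalues of the Gram matrix, to
  the bound on norms of images (\<open>spectral_norm_bound\<close>). This is the variational principle for
  the largest eigenvalue of a symmetric matrix (\<open>symmetric_max_eigenvalue\<close>).
\<close>

unbundle no vec_syntax
unbundle no inner_syntax

section \<open>The largest eigenvalue of a real symmetric matrix\<close>

text \<open>
  The unit sphere of dimension \<open>n\<close> is realised inside the space of all real sequences with the
  product topology, as a closed subset of a product of compact intervals: there compactness is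
  Tychonoff's theorem, for every \<open>n\<close> at once. Homogeneity extends the bound on the sphere to all
  vectors.
\<close>

lemma quadratic_form_attains_max:
  fixes a :: "nat \<Rightarrow> nat \<Rightarrow> real"
  assumes "n \<ge> 1"
  obtains x where "(\<Sum>i<n. (x i)\<^sup>2) = 1"
    and "\<And>y. (\<Sum>i<n. \<Sum>j<n. a i j * y i * y j)
           \<le> (\<Sum>i<n. \<Sum>j<n. a i j * x i * x j) * (\<Sum>i<n. (y i)\<^sup>2)"
proof -
  define Q where "Q y = (\<Sum>i<n. \<Sum>j<n. a i j * y i * y j)" for y :: "nat \<Rightarrow> real"
  define N where "N y = (\<Sum>i<n. (y i)\<^sup>2)" for y :: "nat \<Rightarrow> real"
  define C where "C = PiE UNIV (\<lambda>i. if i < n then {-1..1::real} else {0})"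
  have cont: "continuous_on UNIV Q" "continuous_on UNIV N"
    unfolding Q_def N_def by (intro continuous_intros continuous_on_product_coordinates)+
  have "compactin (product_topology (\<lambda>_. euclidean) UNIV) C"
    unfolding C_def by (subst compactin_PiE) (auto simp: compactin_euclidean_iff)
  then have "compact C"
    by (simp add: euclidean_product_topology compactin_euclidean_iff)
  moreover have "closed (N -` {1})"
    using cont(2) by (simp add: closed_vimage)
  ultimately have "compact (C \<inter> N -` {1})"
    by (rule compact_Int_closed)
  moreover have "N (\<lambda>i. if i = 0 then 1 else 0) = 1"
    using assms unfolding N_def by (simp add: if_distrib[of "\<lambda>x. x\<^sup>2"] cong: if_cong)
  then have "(\<lambda>i. if i = 0 then 1 else 0) \<in> C \<inter> N -` {1}"
    using assms by (auto simp: C_def)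
  then have "C \<inter> N -` {1} \<noteq> {}" by blast
  ultimately obtain x where x: "x \<in> C \<inter> N -` {1}" and max: "\<And>y. y \<in> C \<inter> N -` {1} \<Longrightarrow> Q y \<le> Q x"
    using continuous_attains_sup[of "C \<inter> N -` {1}" Q] continuous_on_subset[OF cont(1)] by auto
  have "Q y \<le> Q x * N y" for y
  proof (cases "N y = 0")
    case True
    then have "y i = 0" if "i < n" for i
      using that unfolding N_def by (subst (asm) sum_nonneg_eq_0_iff) auto
    then have "Q y = 0" unfolding Q_def by simp
    then show ?thesis using True by simp
  next
    case False
    then have pos: "N y > 0"
      using sum_nonneg[of "{..<n}" "\<lambda>i. (y i)\<^sup>2"] unfolding N_def by simp
    define z where "z i = (if i < n then y i / sqrt (N y) else 0)" for i
    have Nz: "N z = 1"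
      using pos unfolding N_def[of z] z_def
      by (simp add: power_divide flip: sum_divide_distrib) (simp add: N_def)
    have "\<bar>z i\<bar> \<le> 1" if "i < n" for i
    proof -
      have "(z i)\<^sup>2 \<le> N z"
        unfolding N_def using that by (intro member_le_sum) auto
      then show ?thesis using Nz by (simp add: abs_square_le_1)
    qed
    then have "z i \<in> (if i < n then {-1..1} else {0})" for i
      by (cases "i < n") (fastforce simp: abs_le_iff, simp add: z_def)
    then have "z \<in> C"
      unfolding C_def by auto
    then have "Q z \<le> Q x" using max Nz by simp
    moreover have "Q z = Q y / N y"
      using pos unfolding Q_def z_def
      by (simp add: sum_divide_distrib real_sqrt_mult_self flip: power2_eq_square)
    ultimately show ?thesis using pos by (simp add: field_simps)
  qed
  then show ?thesis using that x unfolding Q_def N_def by auto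
qed

text \<open>
  The function \<open>c |y|\<^sup>2 - a(y, y)\<close> is nonnegative and vanishes at \<open>x\<close>, so its gradient at \<open>x\<close>
  vanishes; by symmetry of \<open>a\<close> this gradient is twice the residual \<open>r\<close> of the eigenvalue
  equation. Only the values on the line from \<open>x\<close> in the direction \<open>r\<close> are needed.
\<close>

lemma quadratic_form_maximizer_eigen:
  fixes a :: "nat \<Rightarrow> nat \<Rightarrow> real" and c :: real
  assumes sym: "\<And>i j. i < n \<Longrightarrow> j < n \<Longrightarrow> a i j = a j i"
    and bound: "\<And>y. (\<Sum>i<n. \<Sum>j<n. a i j * y i * y j) \<le> c * (\<Sum>i<n. (y i)\<^sup>2)"
    and tight: "(\<Sum>i<n. \<Sum>j<n. a i j * x i * x j) = c * (\<Sum>i<n. (x i)\<^sup>2)"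
    and "i < n"
  shows "(\<Sum>j<n. a i j * x j) = c * x i"
proof -
  define r where "r i = c * x i - (\<Sum>j<n. a i j * x j)" for i
  define L where "L = (\<Sum>i<n. (r i)\<^sup>2)"
  define R where "R = c * (\<Sum>i<n. (r i)\<^sup>2) - (\<Sum>i<n. \<Sum>j<n. a i j * r i * r j)"
  have "R \<ge> 0" using bound[of r] by (simp add: R_def)
  have expand: "0 \<le> 2 * s * L + s\<^sup>2 * R" for s
  proof -
    let ?D = "\<Sum>i<n. \<Sum>j<n. a i j * r i * x j"
    have D': "(\<Sum>i<n. \<Sum>j<n. a i j * x i * r j) = ?D"
      by (subst sum.swap) (auto intro!: sum.cong simp: sym mult_ac)
    have q: "(\<Sum>i<n. \<Sum>j<n. a i j * (x i + s * r i) * (x j + s * r j)) =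
      (\<Sum>i<n. \<Sum>j<n. a i j * x i * x j) + s * (\<Sum>i<n. \<Sum>j<n. a i j * x i * r j) + s * ?D
       + s\<^sup>2 * (\<Sum>i<n. \<Sum>j<n. a i j * r i * r j)"
      by (simp add: sum_distrib_left power2_eq_square algebra_simps flip: sum.distrib)
    have nn: "(\<Sum>i<n. (x i + s * r i)\<^sup>2) =
       (\<Sum>i<n. (x i)\<^sup>2) + 2 * s * (\<Sum>i<n. r i * x i) + s\<^sup>2 * (\<Sum>i<n. (r i)\<^sup>2)"
      by (simp add: sum_distrib_left power2_eq_square algebra_simps flip: sum.distrib)
    have L: "L = c * (\<Sum>i<n. r i * x i) - ?D"
      unfolding L_def by (subst power2_eq_square, subst (2) r_def)
        (simp add: sum_distrib_left algebra_simps sum_subtractf)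
    show ?thesis
      using bound[of "\<lambda>i. x i + s * r i"] tight unfolding q nn D' L R_def
      by (simp add: algebra_simps)
  qed
  have "L = 0"
  proof (rule ccontr)
    assume "L \<noteq> 0"
    then have "L\<^sup>2 > 0" by simp
    \<comment> \<open>For \<open>R > 0\<close> the minimiser of \<open>2 s L + s\<^sup>2 R\<close> is \<open>- L / R\<close>; the smaller step
      \<open>- L / (R + 1)\<close> also gives a negative value and covers \<open>R = 0\<close>.\<close>
    have "2 * (- L / (R + 1)) * L + (- L / (R + 1))\<^sup>2 * R = - (L\<^sup>2 * (R + 2)) / (R + 1)\<^sup>2"
      using \<open>R \<ge> 0\<close> by (simp add: divide_simps) (simp add: power2_eq_square algebra_simps)
    moreover have "L\<^sup>2 * (R + 2) / (R + 1)\<^sup>2 > 0"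
      using \<open>R \<ge> 0\<close> \<open>L\<^sup>2 > 0\<close> by simp
    ultimately show False using expand[of "- L / (R + 1)"] by simp
  qed
  then have "r i = 0"
    using \<open>i < n\<close> unfolding L_def by (subst (asm) sum_nonneg_eq_0_iff) auto
  then show ?thesis by (simp add: r_def)
qed

lemma scalar_prod_self_nonneg: "v \<bullet> v \<ge> 0" for v :: "real vec"
  by (simp add: scalar_prod_def sum_nonneg)

lemma scalar_prod_self_pos:
  fixes v :: "real vec"
  assumes "v \<in> carrier_vec n" "v \<noteq> 0\<^sub>v n"
  shows "v \<bullet> v > 0"
proof -
  obtain i where "i < n" "v $ i \<noteq> 0"
    using assms by (metis carrier_vecD eq_vecI index_zero_vec)
  then show ?thesis
    using assms(1) unfolding scalar_prod_def by (intro sum_pos2[of _ i]) (auto simp: zero_less_mult_iff)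
qed

lemma symmetric_max_eigenvalue:
  fixes A :: "real mat"
  assumes A: "A \<in> carrier_mat n n" and sym: "transpose_mat A = A" and "n \<ge> 1"
  obtains c where "eigenvalue A c"
    and "\<And>v. v \<in> carrier_vec n \<Longrightarrow> v \<bullet> (A *\<^sub>v v) \<le> c * (v \<bullet> v)"
proof -
  let ?Q = "\<lambda>y. \<Sum>i<n. \<Sum>j<n. A $$ (i,j) * y i * y j"
  obtain x where x: "(\<Sum>i<n. (x i)\<^sup>2) = 1" and max: "\<And>y. ?Q y \<le> ?Q x * (\<Sum>i<n. (y i)\<^sup>2)"
    using quadratic_form_attains_max[OF \<open>n \<ge> 1\<close>, of "\<lambda>i j. A $$ (i,j)"] by blast
  define c where "c = ?Q x"
  have "A $$ (i,j) = A $$ (j,i)" if "i < n" "j < n" for i j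
    using A that arg_cong[OF sym, of "\<lambda>B. B $$ (j,i)"] by simp
  then have ev: "(\<Sum>j<n. A $$ (i,j) * x j) = c * x i" if "i < n" for i
    using that max x by (intro quadratic_form_maximizer_eigen) (auto simp: c_def)
  have mv: "(A *\<^sub>v v) $ i = (\<Sum>j<n. A $$ (i,j) * v $ j)" if "v \<in> carrier_vec n" "i < n" for v i
    using A that by (simp add: scalar_prod_def atLeast0LessThan)
  have "Matrix.vec n x \<noteq> 0\<^sub>v n"
  proof
    assume "Matrix.vec n x = 0\<^sub>v n"
    then have "x i = 0" if "i < n" for i
      using that by (metis index_vec index_zero_vec(1))
    then show False using x by simp
  qed
  moreover have "A *\<^sub>v Matrix.vec n x = c \<cdot>\<^sub>v Matrix.vec n x"
  proof (rule eq_vecI)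
    fix i assume "i < dim_vec (c \<cdot>\<^sub>v Matrix.vec n x)"
    then have "i < n" by simp
    then show "(A *\<^sub>v Matrix.vec n x) $ i = (c \<cdot>\<^sub>v Matrix.vec n x) $ i"
      using mv[of "Matrix.vec n x" i] ev[of i] by simp
  qed (use A in simp)
  ultimately have "eigenvalue A c"
    using A unfolding eigenvalue_def eigenvector_def by (intro exI[of _ "Matrix.vec n x"]) simp
  moreover have "v \<bullet> (A *\<^sub>v v) \<le> c * (v \<bullet> v)" if v: "v \<in> carrier_vec n" for v
  proof -
    have "v \<bullet> (A *\<^sub>v v) = ?Q (\<lambda>i. v $ i)"
      using A v mv[OF v] unfolding scalar_prod_def
      by (simp add: atLeast0LessThan sum_distrib_left mult_ac)
    moreover have "v \<bullet> v = (\<Sum>i<n. (v $ i)\<^sup>2)"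
      using v unfolding scalar_prod_def by (simp add: atLeast0LessThan power2_eq_square)
    ultimately show ?thesis using max[of "\<lambda>i. v $ i"] by (simp add: c_def)
  qed
  ultimately show ?thesis using that by blast
qed

text \<open>
  The square of the largest singular value is at least the largest eigenvalue \<open>c\<close> of the Gram
  matrix \<open>M\<^sup>T M\<close>, and \<open>v \<bullet> M\<^sup>T M v = M v \<bullet> M v\<close>.
\<close>

lemma
  fixes M :: "real mat"
  assumes M: "M \<in> carrier_mat n n" and "n \<ge> 1"
  shows spectral_norm_nonneg: "0 \<le> spectral_norm M"
    and spectral_norm_bound:
      "v \<in> carrier_vec n \<Longrightarrow> (M *\<^sub>v v) \<bullet> (M *\<^sub>v v) \<le> (spectral_norm M)\<^sup>2 * (v \<bullet> v)"
proof -
  let ?G = "transpose_mat M * M"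
  have G: "?G \<in> carrier_mat n n" using M by simp
  have gram: "w \<bullet> (?G *\<^sub>v w) = (M *\<^sub>v w) \<bullet> (M *\<^sub>v w)"
    if w: "w \<in> carrier_vec n" for w
  proof -
    have "?G *\<^sub>v w = transpose_mat M *\<^sub>v (M *\<^sub>v w)"
      using M w by (intro assoc_mult_mat_vec) auto
    then show ?thesis
      using transpose_vec_mult_scalar[of M n n w "M *\<^sub>v w"] M w
      by (simp add: comm_scalar_prod[of w n])
  qed
  have "transpose_mat ?G = ?G"
    using M by (subst transpose_mult) auto
  then obtain c where c: "eigenvalue ?G c"
    and le: "\<And>w. w \<in> carrier_vec n \<Longrightarrow> w \<bullet> (?G *\<^sub>v w) \<le> c * (w \<bullet> w)"
    using symmetric_max_eigenvalue[OF G _ \<open>n \<ge> 1\<close>] by metis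
  have "finite {e. eigenvalue ?G e}"
  proof -
    have "char_poly ?G \<noteq> 0" using degree_monic_char_poly[OF G] by auto
    then show ?thesis
      unfolding eigenvalue_root_char_poly[OF G] by (rule poly_roots_finite)
  qed
  then have "finite (singular_values M)"
    unfolding singular_values_def by (simp add: setcompr_eq_image)
  then have sc: "sqrt c \<le> spectral_norm M"
    unfolding spectral_norm_def using c by (intro Max_ge) (auto simp: singular_values_def)
  \<comment> \<open>\<^const>\<open>sqrt\<close> of a negative number is negative, so \<open>sqrt c\<close> bounds \<open>c\<close> only once \<open>c \<ge> 0\<close>
    is known; testing any nonzero vector shows it.\<close>
  have "0 \<le> unit_vec n 0 \<bullet> (?G *\<^sub>v unit_vec n 0)"
    using gram[of "unit_vec n 0"] scalar_prod_self_nonneg by simp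
  also have "\<dots> \<le> c * (unit_vec n 0 \<bullet> unit_vec n 0)"
    by (rule le) simp
  finally have "c \<ge> 0"
    using \<open>n \<ge> 1\<close> by simp
  then show "0 \<le> spectral_norm M"
    using sc real_sqrt_ge_zero[of c] by linarith
  show "(M *\<^sub>v v) \<bullet> (M *\<^sub>v v) \<le> (spectral_norm M)\<^sup>2 * (v \<bullet> v)" if v: "v \<in> carrier_vec n"
  proof -
    have "c \<le> (spectral_norm M)\<^sup>2"
      using sc \<open>c \<ge> 0\<close> by (metis real_sqrt_ge_zero real_sqrt_pow2 power_mono)
    then have "c * (v \<bullet> v) \<le> (spectral_norm M)\<^sup>2 * (v \<bullet> v)"
      using scalar_prod_self_nonneg by (rule mult_right_mono)
    then show ?thesis using le[OF v] gram[OF v] by simp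
  qed
qed

section \<open>Determinants of contractions\<close>

text \<open>
  By the intermediate value theorem along \<open>t \<mapsto> det (I - t N)\<close>: a negative value at \<open>t = 1\<close>
  would produce a zero at some \<open>t < 1\<close>, hence a nonzero \<open>v\<close> with \<open>v = t N v\<close>; but \<open>t N v\<close> is
  shorter than \<open>v\<close>.
\<close>

lemma det_one_minus_contraction_nonneg:
  fixes N :: "real mat"
  assumes N: "N \<in> carrier_mat n n"
    and contr: "\<And>v. v \<in> carrier_vec n \<Longrightarrow> (N *\<^sub>v v) \<bullet> (N *\<^sub>v v) \<le> v \<bullet> v"
  shows "Determinant.det (1\<^sub>m n - N) \<ge> 0"
proof (rule ccontr)
  assume neg: "\<not> Determinant.det (1\<^sub>m n - N) \<ge> 0"
  define f where "f t = Determinant.det (1\<^sub>m n - t \<cdot>\<^sub>m N)" for t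
  have carr: "1\<^sub>m n - t \<cdot>\<^sub>m N \<in> carrier_mat n n" for t
    using N by (intro minus_carrier_mat smult_carrier_mat)
  have f: "f t = (\<Sum>p | p permutes {0..<n}. of_int (sign p) *
      (\<Prod>i=0..<n. (if i = p i then 1 else 0) - t * N $$ (i, p i)))" for t
  proof -
    have "p i < n" if "p permutes {0..<n}" "i < n" for p i
      using that permutes_in_image[of p "{0..<n}" i] by simp
    then show ?thesis
      unfolding f_def det_def'[OF carr] using N by (intro sum.cong prod.cong arg_cong2[of _ _ _ _ "(*)"]) auto
  qed
  have "continuous_on {0..1} f"
    unfolding f by (intro continuous_intros)
  moreover have "f 0 = 1"
  proof -
    have "1\<^sub>m n - 0 \<cdot>\<^sub>m N = 1\<^sub>m n" using N by (intro eq_matI) auto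
    then show ?thesis by (simp add: f_def)
  qed
  moreover have f1: "f 1 < 0"
  proof -
    have "1 \<cdot>\<^sub>m N = N" by (intro eq_matI) auto
    then show ?thesis using neg by (simp add: f_def)
  qed
  ultimately obtain t where t: "0 \<le> t" "t \<le> 1" "f t = 0"
    using IVT2'[of f 1 0 0] by auto
  with f1 have "t < 1" by (cases "t = 1") auto
  obtain v where v: "v \<in> carrier_vec n" "v \<noteq> 0\<^sub>v n" "(1\<^sub>m n - t \<cdot>\<^sub>m N) *\<^sub>v v = 0\<^sub>v n"
    using t(3) unfolding f_def det_0_iff_vec_prod_zero[OF carr] by blast
  define w where "w = N *\<^sub>v v"
  have w: "w \<in> carrier_vec n" using N v(1) by (simp add: w_def)
  have "(1\<^sub>m n - t \<cdot>\<^sub>m N) *\<^sub>v v = v - t \<cdot>\<^sub>v w"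
    using N v(1) unfolding w_def by (subst minus_mult_distrib_mat_vec[of _ n n]) auto
  then have diff: "v - t \<cdot>\<^sub>v w = 0\<^sub>v n" using v(3) by simp
  have fixed: "v = t \<cdot>\<^sub>v w"
  proof (rule eq_vecI)
    fix i assume "i < dim_vec (t \<cdot>\<^sub>v w)"
    then have "i < n" using w by simp
    then show "v $ i = (t \<cdot>\<^sub>v w) $ i"
      using arg_cong[OF diff, of "\<lambda>u. u $ i"] v(1) w by simp
  qed (use v(1) w in simp)
  have pos: "v \<bullet> v > 0"
    by (rule scalar_prod_self_pos[OF v(1,2)])
  have "v \<bullet> v = t\<^sup>2 * (w \<bullet> w)"
    using w by (subst (1 2) fixed) (simp add: power2_eq_square)
  also have "\<dots> \<le> t\<^sup>2 * (v \<bullet> v)"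
    using contr[OF v(1)] by (intro mult_left_mono) (auto simp: w_def)
  also have "\<dots> < 1 * (v \<bullet> v)"
    using t(1) \<open>t < 1\<close> pos by (intro mult_strict_right_mono) (auto simp: power_less_one_iff)
  finally show False by simp
qed

section \<open>Sums of determinants over sets of rows\<close>

text \<open>
  Additivity in all rows at once: distributing the product of row entries in each term of the
  Leibniz formula chooses, for every row, one of the two summands.
\<close>

lemma det_add_rows:
  fixes A B :: "nat \<Rightarrow> nat \<Rightarrow> 'a::comm_ring_1"
  shows "Determinant.det (Matrix.mat n n (\<lambda>(i,j). A i j + B i j)) =
    (\<Sum>X\<in>Pow {..<n}. Determinant.det (Matrix.mat n n (\<lambda>(i,j). if i \<in> X then A i j else B i j)))"
proof -
  have prod_split: "(\<Prod>i=0..<n. A i (p i) + B i (p i)) =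
      (\<Sum>X\<in>Pow {..<n}. \<Prod>i=0..<n. if i \<in> X then A i (p i) else B i (p i))" for p
  proof -
    have "(\<Prod>i\<in>X. A i (p i)) * (\<Prod>i\<in>{..<n}-X. B i (p i)) =
        (\<Prod>i=0..<n. if i \<in> X then A i (p i) else B i (p i))" if "X \<subseteq> {..<n}" for X
      using that by (subst prod.If_cases) (auto simp: atLeast0LessThan Int_absorb1 Diff_eq)
    then show ?thesis
      unfolding atLeast0LessThan by (subst prod_add) (auto simp: atLeast0LessThan)
  qed
  let ?P = "{p. p permutes {0..<n}}"
  have perm: "p i < n" if "p \<in> ?P" "i < n" for p i
    using that permutes_in_image[of p "{0..<n}" i] by simp
  have leibniz: "Determinant.det (Matrix.mat n n (\<lambda>(i,j). F i j)) =
      (\<Sum>p\<in>?P. of_int (sign p) * (\<Prod>i=0..<n. F i (p i)))" for F :: "nat \<Rightarrow> nat \<Rightarrow> 'a"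
    unfolding Determinant.det_def by (auto intro!: sum.cong prod.cong simp: perm)
  show ?thesis
    unfolding leibniz prod_split sum_distrib_left by (rule sum.swap)
qed

lemma det_zero_row:
  fixes A :: "'a::comm_ring_1 mat"
  assumes "A \<in> carrier_mat n n" "k < n" "\<And>j. j < n \<Longrightarrow> A $$ (k, j) = 0"
  shows "Determinant.det A = 0"
proof -
  have "(\<Prod>i=0..<n. A $$ (i, p i)) = 0" if "p permutes {0..<n}" for p
    using assms(2,3) permutes_in_image[OF that, of k] by (intro prod_zero bexI[of _ k]) auto
  then show ?thesis unfolding det_def'[OF assms(1)] by simp
qed

lemma bij_betw_pick:
  assumes "finite S"
  shows "bij_betw (pick S) {0..<card S} S"
proof -
  have "inj_on (pick S) {0..<card S}"
    by (rule linorder_inj_onI') (use pick_mono_le[of _ S] in fastforce)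
  moreover have "pick S ` {0..<card S} \<subseteq> S"
    by (auto intro: pick_in_set_le)
  ultimately show ?thesis
    by (metis assms bij_betw_def card_image card_subset_eq card_atLeastLessThan diff_zero)
qed

text \<open>
  In the Leibniz formula of the right-hand matrix a permutation contributes only if it fixes
  every index outside \<open>S\<close>, that is, if it is a permutation of \<open>S\<close>. The increasing enumeration
  \<open>pick S\<close> of \<open>S\<close> carries these to the permutations of \<open>{0..<card S}\<close> and preserves signs.
\<close>

lemma det_principal_submatrix:
  fixes A :: "'a::comm_ring_1 mat"
  assumes A: "A \<in> carrier_mat n n" and S: "S \<subseteq> {..<n}"
  shows "Determinant.det (principal_submatrix A S) =
    Determinant.det (Matrix.mat n n (\<lambda>(i,j). if i \<in> S then A $$ (i,j) else if i = j then 1 else 0))"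
proof -
  have fin: "finite S" using S finite_subset by blast
  let ?B = "Matrix.mat n n (\<lambda>(i,j). if i \<in> S then A $$ (i,j) else if i = j then 1 else 0)"
  let ?I = "{0..<card S}"
  note bij = bij_betw_pick[OF fin]
  have setS: "{i. i < n \<and> i \<in> S} = S" using S by auto
  have "Determinant.det ?B = (\<Sum>p | p permutes {0..<n}. of_int (sign p) * (\<Prod>i=0..<n. ?B $$ (i, p i)))"
    by (rule det_def') simp
  also have "\<dots> = (\<Sum>p | p permutes S. of_int (sign p) * (\<Prod>i=0..<n. ?B $$ (i, p i)))"
  proof (rule sum.mono_neutral_right)
    show "{p. p permutes S} \<subseteq> {p. p permutes {0..<n}}"
      using S by (auto simp: atLeast0LessThan intro: permutes_subset)
    show "\<forall>p \<in> {p. p permutes {0..<n}} - {p. p permutes S}.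
        of_int (sign p) * (\<Prod>i=0..<n. ?B $$ (i, p i)) = 0"
    proof
      fix p assume p: "p \<in> {p. p permutes {0..<n}} - {p. p permutes S}"
      then obtain i where i: "i < n" "i \<notin> S" "p i \<noteq> i"
        using permutes_superset[of p "{0..<n}" S] by auto
      then have "p i < n" using p permutes_in_image[of p "{0..<n}" i] by simp
      then have "?B $$ (i, p i) = 0" using i by simp
      then have "(\<Prod>i=0..<n. ?B $$ (i, p i)) = 0" using i(1) by (intro prod_zero) auto
      then show "of_int (sign p) * (\<Prod>i=0..<n. ?B $$ (i, p i)) = 0" by simp
    qed
  qed (simp add: finite_permutations)
  also have "\<dots> = (\<Sum>p | p permutes S. of_int (sign p) * (\<Prod>i\<in>S. A $$ (i, p i)))"
  proof (rule sum.cong[OF refl])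
    fix p assume "p \<in> {p. p permutes S}"
    then have p: "p permutes S" by simp
    have "(\<Prod>i=0..<n. ?B $$ (i, p i)) = (\<Prod>i\<in>S. ?B $$ (i, p i))"
      using S by (intro prod.mono_neutral_right) (auto simp: permutes_not_in[OF p])
    also have "\<dots> = (\<Prod>i\<in>S. A $$ (i, p i))"
      using S permutes_in_image[OF p] by (intro prod.cong) (auto simp: subset_iff)
    finally show "of_int (sign p) * (\<Prod>i=0..<n. ?B $$ (i, p i)) =
      of_int (sign p) * (\<Prod>i\<in>S. A $$ (i, p i))" by simp
  qed
  also have "\<dots> = (\<Sum>p | p permutes ?I. of_int (sign p) * (\<Prod>i\<in>?I. A $$ (pick S i, pick S (p i))))"
  proof (rule sum.reindex_bij_witness[of _ "map_permutation ?I (pick S)"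
        "map_permutation S (inv_into ?I (pick S))"])
    fix p assume "p \<in> {p. p permutes S}"
    then have p: "p permutes S" by simp
    let ?q = "map_permutation S (inv_into ?I (pick S)) p"
    show "?q \<in> {p. p permutes ?I}"
      using map_permutation_permutes[OF bij_betw_inv_into[OF bij] p] by simp
    show undo: "map_permutation ?I (pick S) ?q = p"
      by (rule map_permutation_compose_inv[OF bij_betw_inv_into[OF bij] p])
        (rule bij_betw_inv_into_right[OF bij])
    have sgn: "sign ?q = sign p"
      using bij_betw_inv_into[OF bij] p fin by (intro sign_map_permutation) (auto simp: bij_betw_def)
    have app: "pick S (?q i) = p (pick S i)" if "i \<in> ?I" for i
      using map_permutation_apply[of "pick S" ?I i ?q] that bij unfolding undo
      by (simp add: bij_betw_def)
    have "(\<Prod>i\<in>?I. A $$ (pick S i, pick S (?q i))) = (\<Prod>i\<in>?I. A $$ (pick S i, p (pick S i)))"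
      by (rule prod.cong) (auto simp: app)
    also have "\<dots> = (\<Prod>i\<in>S. A $$ (i, p i))"
      by (rule prod.reindex_bij_betw[OF bij])
    finally show "of_int (sign ?q) * (\<Prod>i\<in>?I. A $$ (pick S i, pick S (?q i))) =
      of_int (sign p) * (\<Prod>i\<in>S. A $$ (i, p i))" by (simp only: sgn)
  next
    fix q assume "q \<in> {p. p permutes ?I}"
    then have q: "q permutes ?I" by simp
    show "map_permutation ?I (pick S) q \<in> {p. p permutes S}"
      using map_permutation_permutes[OF bij q] by simp
    show "map_permutation S (inv_into ?I (pick S)) (map_permutation ?I (pick S) q) = q"
      by (rule map_permutation_compose_inv[OF bij q]) (rule bij_betw_inv_into_left[OF bij])
  qed
  also have "\<dots> = Determinant.det (principal_submatrix A S)"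
  proof -
    have "principal_submatrix A S \<in> carrier_mat (card S) (card S)"
      using A unfolding principal_submatrix_def submatrix_def by (simp add: setS)
    moreover have "principal_submatrix A S $$ (i, j) = A $$ (pick S i, pick S j)"
      if "i < card S" "j < card S" for i j
      using A that unfolding principal_submatrix_def by (subst submatrix_index) (auto simp: setS)
    moreover have "q i < card S" if "q permutes ?I" "i < card S" for q i
      using that permutes_in_image[of q ?I i] by simp
    ultimately show ?thesis
      by (subst det_def') (auto intro!: sum.cong prod.cong)
  qed
  finally show ?thesis by simp
qed

text \<open>
  The rows of \<open>I - K\<close> at the indices in \<open>S\<close> may be replaced by zero: the terms with \<open>S \<subseteq> X\<close>
  do not see these rows, and every other term becomes the determinant of a matrix with a zero
  row. So the sum over supersets is the full expansion of one determinant whose rows are sums.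
\<close>

lemma sum_over_supersets_eq_minor:
  fixes K :: "'a::comm_ring_1 mat"
  assumes K: "K \<in> carrier_mat n n" and S: "S \<subseteq> {..<n}"
  shows "(\<Sum>X | X \<subseteq> {..<n} \<and> S \<subseteq> X. Determinant.det
      (Matrix.mat n n (\<lambda>(i,j). if i \<in> X then K $$ (i,j) else (1\<^sub>m n - K) $$ (i,j))))
    = Determinant.det (principal_submatrix K S)"
    (is "(\<Sum>X | _. Determinant.det (?m X)) = _")
proof -
  let ?z = "\<lambda>i j. if i \<in> S then 0 else (1\<^sub>m n - K) $$ (i,j)"
  let ?w = "\<lambda>X. Matrix.mat n n (\<lambda>(i,j). if i \<in> X then K $$ (i,j) else ?z i j)"
  have zero: "Determinant.det (?w X) = 0" if X: "X \<in> Pow {..<n} - {X. X \<subseteq> {..<n} \<and> S \<subseteq> X}" for X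
  proof -
    obtain k where "k \<in> S" "k \<notin> X" using X by auto
    then show ?thesis using S by (intro det_zero_row[of _ n k]) auto
  qed
  have "(\<Sum>X | X \<subseteq> {..<n} \<and> S \<subseteq> X. Determinant.det (?m X)) =
      (\<Sum>X | X \<subseteq> {..<n} \<and> S \<subseteq> X. Determinant.det (?w X))"
  proof (rule sum.cong[OF refl])
    fix X assume "X \<in> {X. X \<subseteq> {..<n} \<and> S \<subseteq> X}"
    then have "?m X = ?w X" by (intro eq_matI) auto
    then show "Determinant.det (?m X) = Determinant.det (?w X)" by simp
  qed
  also have "\<dots> = (\<Sum>X\<in>Pow {..<n}. Determinant.det (?w X))"
    by (rule sum.mono_neutral_left) (use zero in auto)
  also have "\<dots> = Determinant.det (Matrix.mat n n (\<lambda>(i,j). K $$ (i,j) + ?z i j))"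
    by (rule det_add_rows[symmetric])
  also have "\<dots> = Determinant.det (principal_submatrix K S)"
  proof -
    have "Matrix.mat n n (\<lambda>(i,j). K $$ (i,j) + ?z i j) =
        Matrix.mat n n (\<lambda>(i,j). if i \<in> S then K $$ (i,j) else if i = j then 1 else 0)"
      using K by (intro eq_matI) auto
    then show ?thesis by (simp only: det_principal_submatrix[OF K S])
  qed
  finally show ?thesis .
qed

section \<open>Criterion for being a DPP kernel\<close>

text \<open>
  The determinants in the assumption are the probabilities of the single sets \<open>X\<close>; nonnegativity
  is the only condition, since their sums over supersets, and hence their total, are right for
  every \<open>K\<close>.
\<close>

lemma DPP_kernelI:
  assumes K: "K \<in> carrier_mat n n"
    and nonneg: "\<And>X. X \<subseteq> {..<n} \<Longrightarrow> Determinant.det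
      (Matrix.mat n n (\<lambda>(i,j). if i \<in> X then K $$ (i,j) else (1\<^sub>m n - K) $$ (i,j))) \<ge> 0"
  shows "DPP_kernel n K"
proof -
  define p where "p X = Determinant.det
      (Matrix.mat n n (\<lambda>(i,j). if i \<in> X then K $$ (i,j) else (1\<^sub>m n - K) $$ (i,j)))" for X
  define P where "P = point_measure (Pow {..<n}) (\<lambda>X. ennreal (p X))"
  have sets: "sets P = Pow (Pow {..<n})" and space: "space P = Pow {..<n}"
    by (simp_all add: P_def sets_point_measure space_point_measure)
  have p0: "p X \<ge> 0" if "X \<in> Pow {..<n}" for X
    using nonneg that by (simp add: p_def)
  have supersets: "(\<Sum>X | X \<subseteq> {..<n} \<and> S \<subseteq> X. p X) = Determinant.det (principal_submatrix K S)"
    if "S \<subseteq> {..<n}" for S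
    unfolding p_def by (rule sum_over_supersets_eq_minor[OF K that])
  have em: "emeasure P A = ennreal (\<Sum>X\<in>A. p X)" if "A \<subseteq> Pow {..<n}" for A
    using that p0 unfolding P_def
    by (subst emeasure_point_measure_finite) (auto intro!: sum_ennreal simp: subset_iff)
  have m: "measure P A = (\<Sum>X\<in>A. p X)" if "A \<subseteq> Pow {..<n}" for A
    using that p0 by (subst Sigma_Algebra.measure_def)
      (auto simp: em subset_iff intro!: enn2real_ennreal sum_nonneg)
  have "(\<Sum>X\<in>Pow {..<n}. p X) = 1"
    using supersets[of "{}"] by (simp add: det_principal_submatrix_empty Pow_def)
  then have prob: "prob_space P"
    by (intro prob_spaceI) (simp add: space em)
  moreover have "signed_measure_on (Pow (Pow {..<n})) (measure P)"
    unfolding signed_measure_on_def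
  proof (intro conjI allI impI)
    interpret prob_space P by (rule prob)
    fix A :: "nat \<Rightarrow> nat set set"
    assume "range A \<subseteq> Pow (Pow {..<n})" "disjoint_family A"
    then show "(\<lambda>i. measure P (A i)) sums measure P (\<Union>i. A i)"
      by (intro finite_measure_UNION) (simp_all add: sets)
  qed simp
  moreover have "measure P {X \<in> Pow {..<n}. S \<subseteq> X} = Determinant.det (principal_submatrix K S)"
    if "S \<subseteq> {..<n}" for S
    using supersets[OF that] by (subst m) auto
  ultimately show ?thesis
    unfolding DPP_kernel_def determinantal_measure_def using K sets by blast
qed

section \<open>Contractions give DPP kernels\<close>

theorem proposition2p4:
  fixes n :: nat and M :: "real mat"
  assumes "n \<ge> 1"
    and "M \<in> carrier_mat n n"
    and "spectral_norm M \<le> 1"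
  shows "DPP_kernel n ((1/2) \<cdot>\<^sub>m (1\<^sub>m n - M))"
proof (rule DPP_kernelI)
  show "(1/2) \<cdot>\<^sub>m (1\<^sub>m n - M) \<in> carrier_mat n n"
    using assms(2) by (intro smult_carrier_mat minus_carrier_mat)
  fix X assume "X \<subseteq> {..<n}"
  let ?K = "(1/2) \<cdot>\<^sub>m (1\<^sub>m n - M)"
  define N where "N = Matrix.mat n n (\<lambda>(i,j). if i \<in> X then M $$ (i,j) else - M $$ (i,j))"
  have N: "N \<in> carrier_mat n n" by (simp add: N_def)
  have "(N *\<^sub>v v) \<bullet> (N *\<^sub>v v) \<le> v \<bullet> v" if v: "v \<in> carrier_vec n" for v
  proof -
    have entry: "(N *\<^sub>v v) $ i = (if i \<in> X then (M *\<^sub>v v) $ i else - (M *\<^sub>v v) $ i)" if "i < n" for i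
      using that assms(2) v by (simp add: N_def scalar_prod_def sum_negf)
    have "(N *\<^sub>v v) \<bullet> (N *\<^sub>v v) = (\<Sum>i=0..<n. (N *\<^sub>v v) $ i * (N *\<^sub>v v) $ i)"
      using N by (simp add: scalar_prod_def)
    also have "\<dots> = (\<Sum>i=0..<n. (M *\<^sub>v v) $ i * (M *\<^sub>v v) $ i)"
      by (rule sum.cong) (auto simp: entry)
    also have "\<dots> = (M *\<^sub>v v) \<bullet> (M *\<^sub>v v)"
      using assms(2) by (simp add: scalar_prod_def)
    finally have "(N *\<^sub>v v) \<bullet> (N *\<^sub>v v) = (M *\<^sub>v v) \<bullet> (M *\<^sub>v v)" .
    also have "\<dots> \<le> (spectral_norm M)\<^sup>2 * (v \<bullet> v)"
      by (rule spectral_norm_bound[OF assms(2,1) v])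
    also have "\<dots> \<le> 1 * (v \<bullet> v)"
      using assms(3) spectral_norm_nonneg[OF assms(2,1)] scalar_prod_self_nonneg[of v]
      by (intro mult_right_mono) (auto simp: power_le_one)
    finally show ?thesis by simp
  qed
  then have "Determinant.det (1\<^sub>m n - N) \<ge> 0"
    by (rule det_one_minus_contraction_nonneg[OF N])
  moreover have "Matrix.mat n n (\<lambda>(i,j). if i \<in> X then ?K $$ (i,j) else (1\<^sub>m n - ?K) $$ (i,j)) =
      (1/2) \<cdot>\<^sub>m (1\<^sub>m n - N)"
    using assms(2) by (intro eq_matI) (auto simp: N_def field_simps)
  ultimately show "Determinant.det (Matrix.mat n n
      (\<lambda>(i,j). if i \<in> X then ?K $$ (i,j) else (1\<^sub>m n - ?K) $$ (i,j))) \<ge> 0"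
    by simp
qed

end
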